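(* Let $\mathcal{C}$ be a class of finite $L$-structures, $R$ a set of functions $\mathcal{C}\to\mathbb{R}^{\ge0}$, and $\langle R\rangle$ the ring generated by $R$ under the usual addition and multiplication of real-valued functions. (i) Suppose that $\mathcal{C}$ satisfies the definition of an $R$-m.a.c. for formulas $\phi(x;\bar y)$ where $x$ is a single variable. Then $\mathcal{C}$ is an $\langle R\rangle$-m.a.c. (ii) The assertion of (i) holds with m.e.c.s in place of m.a.c.s.
   Context: For a tuple $\bar y$ of variables, $(\mathcal{C},\bar y)$ denotes the set of pairs $(M,\bar a)$ with $M\in\mathcal{C}$, $\bar a\in M^{|\bar y|}$. A partition $\Pi$ of $(\mathcal{C},\bar y)$ is $\emptyset$-definable if for each $\pi\in\Pi$ there is a parameter-free $L$-formula $\phi_\pi(\bar y)$ with $\phi_\pi(M^{|\bar y|})=\{\bar b\in M^{|\bar{y}|}:(M,\bar b)\in\pi\}$ for all $M\in\mathcal{C}$. $\mathcal{C}$ is an $R$-multidimensional asymptotic class ($R$-m.a.c.) if for every $L$-formula $\phi(\bar x;\bar y)$ there is a finite $\emptyset$-definable partition $\Pi$ of $(\mathcal{C},\bar y)$ and functions $h_\pi\in R$ ($\pi\in\Pi$) such that for each $\pi\in\Pi$ and every $\epsilon>0$ there is $Q\in\mathbb{N}$ such that for all $(M,\bar b)\in\pi$ with $|M|>Q$, $\big||\phi(M^{|\bar x|};\bar b)|-h_\pi(M)\big|\le\epsilon h_\pi(M)$. $\mathcal{C}$ is an $R$-m.e.c. if instead $|\phi(M^{|\bar x|};\bar b)|=h_\pi(M)$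 for all $(M,\bar b)\in\pi$. The notion of $\langle R\rangle$-m.a.c. (m.e.c.) is this definition with measuring functions taken among the non-negative-valued elements of $\langle R\rangle$. *)

theory Defs
  imports "HOL-Algebra.Generated_Rings" "HOL-Library.Disjoint_Sets" "HOL-Library.FuncSet" Complex_Main
begin

section \<open>First-order languages, structures and formulas\<close>

text \<open>The symbols of a language are explicit sets rather than whole types because HOL types are
  non-empty and, for example, purely relational languages must be covered. Constants are nullary
  function symbols.\<close>

record ('f, 'r) language =
  fun_syms :: "'f set"
  rel_syms :: "'r set"
  fun_arity :: "'f \<Rightarrow> nat"
  rel_arity :: "'r \<Rightarrow> nat"

record ('f, 'r, 'a) struct =
  univ :: "'a set"
  fun_interp :: "'f \<Rightarrow> 'a list \<Rightarrow> 'a"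
  rel_interp :: "'r \<Rightarrow> 'a list set"

definition tuples :: "('f, 'r, 'a) struct \<Rightarrow> nat \<Rightarrow> 'a list set" where
  "tuples M n = {as. set as \<subseteq> univ M \<and> length as = n}"

definition is_structure :: "('f, 'r) language \<Rightarrow> ('f, 'r, 'a) struct \<Rightarrow> bool" where
  "is_structure L M \<longleftrightarrow>
     univ M \<noteq> {} \<and>
     (\<forall>f\<in>fun_syms L. fun_interp M f \<in> tuples M (fun_arity L f) \<rightarrow> univ M) \<and>
     (\<forall>r\<in>rel_syms L. rel_interp M r \<subseteq> tuples M (rel_arity L r))"

datatype 'f trm = Var nat | App 'f "'f trm list"

datatype ('f, 'r) formula =
    Equal "'f trm" "'f trm"
  | Rel 'r "'f trm list"
  | Neg "('f, 'r) formula"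
  | Conj "('f, 'r) formula" "('f, 'r) formula"
  | Exists nat "('f, 'r) formula"

fun is_term :: "('f, 'r) language \<Rightarrow> 'f trm \<Rightarrow> bool" where
  "is_term L (Var v) \<longleftrightarrow> True"
| "is_term L (App f ts) \<longleftrightarrow>
     f \<in> fun_syms L \<and> length ts = fun_arity L f \<and> (\<forall>t\<in>set ts. is_term L t)"

fun is_formula :: "('f, 'r) language \<Rightarrow> ('f, 'r) formula \<Rightarrow> bool" where
  "is_formula L (Equal s t) \<longleftrightarrow> is_term L s \<and> is_term L t"
| "is_formula L (Rel r ts) \<longleftrightarrow>
     r \<in> rel_syms L \<and> length ts = rel_arity L r \<and> (\<forall>t\<in>set ts. is_term L t)"
| "is_formula L (Neg \<phi>) \<longleftrightarrow> is_formula L \<phi>"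
| "is_formula L (Conj \<phi> \<psi>) \<longleftrightarrow> is_formula L \<phi> \<and> is_formula L \<psi>"
| "is_formula L (Exists v \<phi>) \<longleftrightarrow> is_formula L \<phi>"

fun term_vars :: "'f trm \<Rightarrow> nat set" where
  "term_vars (Var v) = {v}"
| "term_vars (App f ts) = (\<Union>t\<in>set ts. term_vars t)"

fun free_vars :: "('f, 'r) formula \<Rightarrow> nat set" where
  "free_vars (Equal s t) = term_vars s \<union> term_vars t"
| "free_vars (Rel r ts) = (\<Union>t\<in>set ts. term_vars t)"
| "free_vars (Neg \<phi>) = free_vars \<phi>"
| "free_vars (Conj \<phi> \<psi>) = free_vars \<phi> \<union> free_vars \<psi>"
| "free_vars (Exists v \<phi>) = free_vars \<phi> - {v}"

fun eval_term :: "('f, 'r, 'a) struct \<Rightarrow> (nat \<Rightarrow> 'a) \<Rightarrow> 'f trm \<Rightarrow> 'a" where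
  "eval_term M s (Var v) = s v"
| "eval_term M s (App f ts) = fun_interp M f (map (eval_term M s) ts)"

fun sat :: "('f, 'r, 'a) struct \<Rightarrow> (nat \<Rightarrow> 'a) \<Rightarrow> ('f, 'r) formula \<Rightarrow> bool" where
  "sat M s (Equal t u) \<longleftrightarrow> eval_term M s t = eval_term M s u"
| "sat M s (Rel r ts) \<longleftrightarrow> map (eval_term M s) ts \<in> rel_interp M r"
| "sat M s (Neg \<phi>) \<longleftrightarrow> \<not> sat M s \<phi>"
| "sat M s (Conj \<phi> \<psi>) \<longleftrightarrow> sat M s \<phi> \<and> sat M s \<psi>"
| "sat M s (Exists v \<phi>) \<longleftrightarrow> (\<exists>a\<in>univ M. sat M (s(v := a)) \<phi>)"

text \<open>Only the values at variables in \<open>vs\<close> are meaningful; it is only used for formulas whose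
  free variables all lie in \<open>vs\<close>.\<close>

definition assignment :: "nat list \<Rightarrow> 'a list \<Rightarrow> nat \<Rightarrow> 'a" where
  "assignment vs as v = the (map_of (zip vs as) v)"

text \<open>\<open>formula_in L \<phi> xs ys\<close> says that \<open>\<phi>\<close> is an \<open>L\<close>-formula written as \<open>\<phi>(xs; ys)\<close>, and
  \<open>solutions M \<phi> xs ys bs\<close> is then the set \<open>\<phi>(M\<^sup>n; bs)\<close>, \<open>n\<close> being the length of \<open>xs\<close>.\<close>

definition formula_in ::
    "('f, 'r) language \<Rightarrow> ('f, 'r) formula \<Rightarrow> nat list \<Rightarrow> nat list \<Rightarrow> bool" where
  "formula_in L \<phi> xs ys \<longleftrightarrow>
     is_formula L \<phi> \<and> distinct (xs @ ys) \<and> free_vars \<phi> \<subseteq> set xs \<union> set ys"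

definition solutions ::
    "('f, 'r, 'a) struct \<Rightarrow> ('f, 'r) formula \<Rightarrow> nat list \<Rightarrow> nat list \<Rightarrow> 'a list \<Rightarrow> 'a list set" where
  "solutions M \<phi> xs ys bs =
     {as \<in> tuples M (length xs). sat M (assignment (xs @ ys) (as @ bs)) \<phi>}"


section \<open>Multidimensional asymptotic and exact classes\<close>

definition pairs ::
    "('f, 'r, 'a) struct set \<Rightarrow> nat list \<Rightarrow> (('f, 'r, 'a) struct \<times> 'a list) set" where
  "pairs C ys = (SIGMA M:C. tuples M (length ys))"

definition definable_partition ::
    "('f, 'r) language \<Rightarrow> ('f, 'r, 'a) struct set \<Rightarrow> nat list \<Rightarrow>
     (('f, 'r, 'a) struct \<times> 'a list) set set \<Rightarrow> bool" where
  "definable_partition L C ys P \<longleftrightarrow>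
     partition_on (pairs C ys) P \<and>
     (\<forall>\<pi>\<in>P. \<exists>\<psi>. formula_in L \<psi> ys [] \<and>
        (\<forall>M\<in>C. solutions M \<psi> ys [] [] = {bs \<in> tuples M (length ys). (M, bs) \<in> \<pi>}))"

definition mac_formula ::
    "('f, 'r) language \<Rightarrow> ('f, 'r, 'a) struct set \<Rightarrow> (('f, 'r, 'a) struct \<Rightarrow> real) set \<Rightarrow>
     ('f, 'r) formula \<Rightarrow> nat list \<Rightarrow> nat list \<Rightarrow> bool" where
  "mac_formula L C R \<phi> xs ys \<longleftrightarrow>
     (\<exists>P h. finite P \<and> definable_partition L C ys P \<and> (\<forall>\<pi>\<in>P. h \<pi> \<in> R) \<and>
        (\<forall>\<pi>\<in>P. \<forall>\<epsilon>::real. \<epsilon> > 0 \<longrightarrow>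
           (\<exists>Q::nat. \<forall>(M, bs)\<in>\<pi>. card (univ M) > Q \<longrightarrow>
              \<bar>real (card (solutions M \<phi> xs ys bs)) - h \<pi> M\<bar> \<le> \<epsilon> * h \<pi> M)))"

definition mec_formula ::
    "('f, 'r) language \<Rightarrow> ('f, 'r, 'a) struct set \<Rightarrow> (('f, 'r, 'a) struct \<Rightarrow> real) set \<Rightarrow>
     ('f, 'r) formula \<Rightarrow> nat list \<Rightarrow> nat list \<Rightarrow> bool" where
  "mec_formula L C R \<phi> xs ys \<longleftrightarrow>
     (\<exists>P h. finite P \<and> definable_partition L C ys P \<and> (\<forall>\<pi>\<in>P. h \<pi> \<in> R) \<and>
        (\<forall>\<pi>\<in>P. \<forall>(M, bs)\<in>\<pi>. real (card (solutions M \<phi> xs ys bs)) = h \<pi> M))"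

definition is_mac ::
    "('f, 'r) language \<Rightarrow> ('f, 'r, 'a) struct set \<Rightarrow> (('f, 'r, 'a) struct \<Rightarrow> real) set \<Rightarrow> bool" where
  "is_mac L C R \<longleftrightarrow> (\<forall>\<phi> xs ys. formula_in L \<phi> xs ys \<longrightarrow> mac_formula L C R \<phi> xs ys)"

definition is_mec ::
    "('f, 'r) language \<Rightarrow> ('f, 'r, 'a) struct set \<Rightarrow> (('f, 'r, 'a) struct \<Rightarrow> real) set \<Rightarrow> bool" where
  "is_mec L C R \<longleftrightarrow> (\<forall>\<phi> xs ys. formula_in L \<phi> xs ys \<longrightarrow> mec_formula L C R \<phi> xs ys)"

text \<open>A function on \<open>C\<close> is represented by a total function of which only the values on \<open>C\<close> are
  used. Restriction to \<open>C\<close> is a ring homomorphism, so it maps the subring generated by \<open>R\<close> below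
  onto the ring generated by the restrictions of the elements of \<open>R\<close>. The generated ring
  is unital.\<close>

definition real_fun_ring :: "('m \<Rightarrow> real) ring" where
  "real_fun_ring = \<lparr>carrier = UNIV, mult = (\<lambda>f g M. f M * g M), one = (\<lambda>M. 1),
     zero = (\<lambda>M. 0), add = (\<lambda>f g M. f M + g M)\<rparr>"

lemma cring_real_fun_ring: "cring (real_fun_ring :: ('m \<Rightarrow> real) ring)"
proof (rule cringI)
  show "abelian_group (real_fun_ring :: ('m \<Rightarrow> real) ring)"
  proof (rule abelian_groupI)
    fix f :: "'m \<Rightarrow> real"
    show "\<exists>g\<in>carrier real_fun_ring. g \<oplus>\<^bsub>real_fun_ring\<^esub> f = \<zero>\<^bsub>real_fun_ring\<^esub>"
      by (rule bexI[of _ "\<lambda>M. - f M"]) (simp_all add: real_fun_ring_def)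
  qed (simp_all add: real_fun_ring_def algebra_simps)
  show "comm_monoid (real_fun_ring :: ('m \<Rightarrow> real) ring)"
    by (rule comm_monoidI) (simp_all add: real_fun_ring_def algebra_simps)
qed (simp add: real_fun_ring_def algebra_simps)

definition generated_ring :: "('m \<Rightarrow> real) set \<Rightarrow> ('m \<Rightarrow> real) set" where
  "generated_ring R = generate_ring real_fun_ring R"

definition generated_nonneg :: "'m set \<Rightarrow> ('m \<Rightarrow> real) set \<Rightarrow> ('m \<Rightarrow> real) set" where
  "generated_nonneg C R = {h \<in> generated_ring R. \<forall>M\<in>C. h M \<ge> 0}"

end

theory Submission
  imports Defs
begin

text \<open>
  Fibre the solution set of \<open>\<phi>(x, xs; ys)\<close> over the tuples \<open>xs\<close>. Read as \<open>\<phi>(x; xs, ys)\<close>, the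
  formula has one object variable, so the hypothesis provides finitely many definable classes
  \<open>\<pi>\<close>, covering all values of \<open>(xs, ys)\<close>, on each of which the number of \<open>x\<close> is measured by a
  single function \<open>h\<^sub>\<pi> \<in> R\<close>. If \<open>\<psi>\<^sub>\<pi>\<close> defines \<open>\<pi>\<close>, then \<open>\<psi>\<^sub>\<pi>(xs; ys)\<close> has fewer object
  variables, and by induction its number of solutions is measured on finitely many definable
  classes of \<open>ys\<close> by functions \<open>g\<close> of the generated ring. The tuples \<open>xs\<close> in \<open>\<psi>\<^sub>\<pi>(M; bs)\<close> carry
  about \<open>h\<^sub>\<pi>\<close> solutions each, hence \<open>h\<^sub>\<pi> * g\<close> together (\<open>measured_fibre_sum\<close>). Summing
  over \<open>\<pi>\<close> on the common refinement of the partitions of \<open>ys\<close> (\<open>measured_sum\<close>) measures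
  the whole solution set by \<open>\<Sum>\<^sub>\<pi> h\<^sub>\<pi> * g\<^sub>\<pi>\<close>, an element of the ring which is non-negative
  because all its ingredients are. Without object variables the number of solutions is the truth
  value of the formula, measured by the constants \<open>0\<close> and \<open>1\<close>.

  Relative errors behave well here because all measuring functions are non-negative: errors
  in a sum add up without cancellation in the main term, and a product of two
  \<open>\<delta>\<close>-approximations is a \<open>3\<delta>\<close>-approximation for \<open>\<delta> \<le> 1\<close>. The exact case is the same
  argument with the only admitted error \<open>0\<close>, so both are treated at once by the predicate
  \<open>measured\<close>.
\<close>

section \<open>Definable partitions\<close>

lemma definable_partition_iff:
  "definable_partition L C ys P \<longleftrightarrow>
     partition_on (pairs C ys) P \<and>
     (\<forall>\<pi>\<in>P. \<exists>\<psi>. formula_in L \<psi> ys [] \<and>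
        (\<forall>(M, bs)\<in>pairs C ys. sat M (assignment ys bs) \<psi> \<longleftrightarrow> (M, bs) \<in> \<pi>))"
  unfolding definable_partition_def solutions_def pairs_def by (fastforce simp: set_eq_iff)

lemma definable_partition_sat:
  assumes "formula_in L \<phi> ys []"
  shows "definable_partition L C ys
    ({{(M, bs) \<in> pairs C ys. sat M (assignment ys bs) \<phi>},
      {(M, bs) \<in> pairs C ys. \<not> sat M (assignment ys bs) \<phi>}} - {{}})"
    (is "definable_partition L C ys ({?S, ?N} - {{}})")
  unfolding definable_partition_iff
proof (intro conjI ballI)
  show "partition_on (pairs C ys) ({?S, ?N} - {{}})"
    by (rule partition_onI) (auto simp: disjnt_def)
  have neg: "formula_in L (Neg \<phi>) ys []"
    using assms by (simp add: formula_in_def)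
  fix \<pi> assume "\<pi> \<in> {?S, ?N} - {{}}"
  then consider "\<pi> = ?S" | "\<pi> = ?N" by blast
  then show "\<exists>\<psi>. formula_in L \<psi> ys [] \<and>
      (\<forall>(M, bs)\<in>pairs C ys. sat M (assignment ys bs) \<psi> \<longleftrightarrow> (M, bs) \<in> \<pi>)"
  proof cases
    case 1
    then show ?thesis using assms by (intro exI[of _ \<phi>]) auto
  next
    case 2
    then show ?thesis using neg by (intro exI[of _ "Neg \<phi>"]) auto
  qed
qed

text \<open>Two functions can only be added class by class on a partition that serves both of them;
  an intersection of two classes is defined by a conjunction.\<close>

lemma definable_partition_common_refinement:
  assumes "definable_partition L C ys P" and "definable_partition L C ys P'"
  shows "definable_partition L C ys ((\<lambda>(\<pi>, \<pi>'). \<pi> \<inter> \<pi>') ` (P \<times> P') - {{}})"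
  unfolding definable_partition_iff
proof (intro conjI ballI)
  have P: "partition_on (pairs C ys) P" and P': "partition_on (pairs C ys) P'"
    using assms by (simp_all add: definable_partition_def)
  show "partition_on (pairs C ys) ((\<lambda>(\<pi>, \<pi>'). \<pi> \<inter> \<pi>') ` (P \<times> P') - {{}})"
  proof (rule partition_onI)
    have "\<Union> ((\<lambda>(\<pi>, \<pi>'). \<pi> \<inter> \<pi>') ` (P \<times> P') - {{}}) = \<Union>P \<inter> \<Union>P'"
      by auto
    then show "\<Union> ((\<lambda>(\<pi>, \<pi>'). \<pi> \<inter> \<pi>') ` (P \<times> P') - {{}}) = pairs C ys"
      using partition_onD1[OF P] partition_onD1[OF P'] by simp
    fix p q
    assume "p \<in> (\<lambda>(\<pi>, \<pi>'). \<pi> \<inter> \<pi>') ` (P \<times> P') - {{}}"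
      and "q \<in> (\<lambda>(\<pi>, \<pi>'). \<pi> \<inter> \<pi>') ` (P \<times> P') - {{}}" and "p \<noteq> q"
    then obtain \<pi> \<pi>' \<rho> \<rho>' where "\<pi> \<in> P" "\<rho> \<in> P" "\<pi>' \<in> P'" "\<rho>' \<in> P'"
      and pq: "p = \<pi> \<inter> \<pi>'" "q = \<rho> \<inter> \<rho>'" and "\<pi> \<noteq> \<rho> \<or> \<pi>' \<noteq> \<rho>'"
      by auto
    then have "\<pi> \<inter> \<rho> = {} \<or> \<pi>' \<inter> \<rho>' = {}"
      using disjointD[OF partition_onD2[OF P]] disjointD[OF partition_onD2[OF P']] by metis
    then show "disjnt p q"
      unfolding pq disjnt_def by auto
  qed simp
  fix p assume "p \<in> (\<lambda>(\<pi>, \<pi>'). \<pi> \<inter> \<pi>') ` (P \<times> P') - {{}}"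
  then obtain \<pi> \<pi>' where "\<pi> \<in> P" "\<pi>' \<in> P'" and p: "p = \<pi> \<inter> \<pi>'"
    by auto
  obtain \<psi> where "formula_in L \<psi> ys []"
    "\<forall>(M, bs)\<in>pairs C ys. sat M (assignment ys bs) \<psi> \<longleftrightarrow> (M, bs) \<in> \<pi>"
    using assms(1) \<open>\<pi> \<in> P\<close> unfolding definable_partition_iff by blast
  moreover obtain \<psi>' where "formula_in L \<psi>' ys []"
    "\<forall>(M, bs)\<in>pairs C ys. sat M (assignment ys bs) \<psi>' \<longleftrightarrow> (M, bs) \<in> \<pi>'"
    using assms(2) \<open>\<pi>' \<in> P'\<close> unfolding definable_partition_iff by blast
  ultimately show "\<exists>\<psi>. formula_in L \<psi> ys [] \<and>
      (\<forall>(M, bs)\<in>pairs C ys. sat M (assignment ys bs) \<psi> \<longleftrightarrow> (M, bs) \<in> p)"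
    by (intro exI[of _ "Conj \<psi> \<psi>'"]) (auto simp: formula_in_def p)
qed

section \<open>Measured functions\<close>

text \<open>Asymptotic and exact measuring differ in the relative errors \<open>\<epsilon> \<in> T\<close> that are imposed and
  in the structures that may be ignored, which a filter \<open>F\<close> describes. Sizes tending to infinity
  and \<open>T = {0<..}\<close> give the asymptotic notion; the filter that ignores nothing and \<open>T = {0}\<close>
  give the exact one. The counted quantity is an arbitrary real function \<open>c\<close> so that sums over
  fibres are covered.\<close>

definition measured ::
    "real set \<Rightarrow> ('f, 'r, 'a) struct filter \<Rightarrow> ('f, 'r) language \<Rightarrow> ('f, 'r, 'a) struct set \<Rightarrow>
     (('f, 'r, 'a) struct \<Rightarrow> real) set \<Rightarrow> nat list \<Rightarrow>
     (('f, 'r, 'a) struct \<Rightarrow> 'a list \<Rightarrow> real) \<Rightarrow> bool" where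
  "measured T F L C R ys c \<longleftrightarrow>
     (\<exists>P h. finite P \<and> definable_partition L C ys P \<and> (\<forall>\<pi>\<in>P. h \<pi> \<in> R) \<and>
        (\<forall>\<pi>\<in>P. \<forall>\<epsilon>\<in>T. \<forall>\<^sub>F M in F. \<forall>bs. (M, bs) \<in> \<pi> \<longrightarrow>
           \<bar>c M bs - h \<pi> M\<bar> \<le> \<epsilon> * h \<pi> M))"

lemma measuredE:
  assumes "measured T F L C R ys c"
  obtains P h where "finite P" and "definable_partition L C ys P" and "\<forall>\<pi>\<in>P. h \<pi> \<in> R"
    and "\<forall>\<pi>\<in>P. \<forall>\<epsilon>\<in>T.
      \<forall>\<^sub>F M in F. \<forall>bs. (M, bs) \<in> \<pi> \<longrightarrow> \<bar>c M bs - h \<pi> M\<bar> \<le> \<epsilon> * h \<pi> M"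
  using assms unfolding measured_def by blast

text \<open>The closure under passing to a third is what a multiplication costs; it holds for
  \<open>{0<..}\<close> and for \<open>{0}\<close>.\<close>

definition admissible_tolerances :: "real set \<Rightarrow> bool" where
  "admissible_tolerances T \<longleftrightarrow> (\<forall>\<epsilon>\<in>T. \<epsilon> \<ge> 0 \<and> (\<exists>\<delta>\<in>T. \<delta> \<le> 1 \<and> 3 * \<delta> \<le> \<epsilon>))"

lemma mac_formula_iff_measured:
  fixes C :: "('f, 'r, 'a) struct set"
  shows "mac_formula L C R \<phi> xs ys \<longleftrightarrow>
     measured {0<..} (filtercomap (\<lambda>M. card (univ M)) at_top) L C R ys
       (\<lambda>M bs. real (card (solutions M \<phi> xs ys bs)))"
proof -
  have eventually_card: "(\<exists>Q::nat. \<forall>(M, bs)\<in>\<pi>. card (univ M) > Q \<longrightarrow> X M bs) \<longleftrightarrow>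
      (\<forall>\<^sub>F M in filtercomap (\<lambda>M. card (univ M)) at_top. \<forall>bs. (M, bs) \<in> \<pi> \<longrightarrow> X M bs)"
    for X and \<pi> :: "(('f, 'r, 'a) struct \<times> 'a list) set"
    by (auto simp: eventually_filtercomap_at_top_dense Ball_def)
  show ?thesis
    unfolding mac_formula_def measured_def eventually_card by (simp add: Ball_def)
qed

lemma mec_formula_iff_measured:
  fixes C :: "('f, 'r, 'a) struct set"
  shows "mec_formula L C R \<phi> xs ys \<longleftrightarrow>
     measured {0} top_class.top L C R ys (\<lambda>M bs. real (card (solutions M \<phi> xs ys bs)))"
proof -
  have split_pair: "(\<forall>(M, bs)\<in>\<pi>. X M bs) \<longleftrightarrow> (\<forall>M bs. (M, bs) \<in> \<pi> \<longrightarrow> X M bs)"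
    for X and \<pi> :: "(('f, 'r, 'a) struct \<times> 'a list) set"
    by auto
  show ?thesis
    unfolding mec_formula_def measured_def split_pair by simp
qed

lemma measured_cong:
  assumes "measured T F L C R ys c"
    and "\<And>M bs. (M, bs) \<in> pairs C ys \<Longrightarrow> c M bs = c' M bs"
  shows "measured T F L C R ys c'"
proof -
  obtain P h where P: "finite P" "definable_partition L C ys P" "\<forall>\<pi>\<in>P. h \<pi> \<in> R"
    and h: "\<forall>\<pi>\<in>P. \<forall>\<epsilon>\<in>T.
      \<forall>\<^sub>F M in F. \<forall>bs. (M, bs) \<in> \<pi> \<longrightarrow> \<bar>c M bs - h \<pi> M\<bar> \<le> \<epsilon> * h \<pi> M"
    using assms(1) by (rule measuredE)
  have "\<forall>\<^sub>F M in F. \<forall>bs. (M, bs) \<in> \<pi> \<longrightarrow> \<bar>c' M bs - h \<pi> M\<bar> \<le> \<epsilon> * h \<pi> M"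
    if "\<pi> \<in> P" "\<epsilon> \<in> T" for \<pi> \<epsilon>
  proof -
    have "\<pi> \<subseteq> pairs C ys"
      using P(2) that(1) partition_onD1 unfolding definable_partition_def by blast
    then show ?thesis
      using assms(2) by (intro eventually_mono[OF h[rule_format, OF that]]) fastforce
  qed
  then show ?thesis
    unfolding measured_def using P by blast
qed

lemma measured_add:
  assumes "measured T F L C R ys c" and "measured T F L C R ys c'"
    and add: "\<And>f g. f \<in> R \<Longrightarrow> g \<in> R \<Longrightarrow> (\<lambda>M. f M + g M) \<in> R"
  shows "measured T F L C R ys (\<lambda>M bs. c M bs + c' M bs)"
proof -
  obtain P h where P: "finite P" "definable_partition L C ys P" "\<forall>\<pi>\<in>P. h \<pi> \<in> R"
    and h: "\<forall>\<pi>\<in>P. \<forall>\<epsilon>\<in>T.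
      \<forall>\<^sub>F M in F. \<forall>bs. (M, bs) \<in> \<pi> \<longrightarrow> \<bar>c M bs - h \<pi> M\<bar> \<le> \<epsilon> * h \<pi> M"
    using assms(1) by (rule measuredE)
  obtain P' h' where P': "finite P'" "definable_partition L C ys P'" "\<forall>\<pi>\<in>P'. h' \<pi> \<in> R"
    and h': "\<forall>\<pi>\<in>P'. \<forall>\<epsilon>\<in>T.
      \<forall>\<^sub>F M in F. \<forall>bs. (M, bs) \<in> \<pi> \<longrightarrow> \<bar>c' M bs - h' \<pi> M\<bar> \<le> \<epsilon> * h' \<pi> M"
    using assms(2) by (rule measuredE)
  define Q where "Q = (\<lambda>(\<pi>, \<pi>'). \<pi> \<inter> \<pi>') ` (P \<times> P') - {{}}"
  have "\<forall>p\<in>Q. \<exists>\<pi>\<in>P. \<exists>\<pi>'\<in>P'. p = \<pi> \<inter> \<pi>'"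
    by (auto simp: Q_def)
  \<comment> \<open>Each class of the refinement remembers one class of either partition that contains it.\<close>
  then obtain l r where lr: "\<And>p. p \<in> Q \<Longrightarrow> l p \<in> P \<and> r p \<in> P' \<and> p = l p \<inter> r p"
    by metis
  show ?thesis
    unfolding measured_def
  proof (intro exI conjI ballI)
    show "finite Q" "definable_partition L C ys Q"
      using P P' definable_partition_common_refinement by (auto simp: Q_def)
    show "(\<lambda>M. h (l p) M + h' (r p) M) \<in> R" if "p \<in> Q" for p
      using lr[OF that] P(3) P'(3) add by blast
    show "\<forall>\<^sub>F M in F. \<forall>bs. (M, bs) \<in> p \<longrightarrow>
        \<bar>c M bs + c' M bs - (h (l p) M + h' (r p) M)\<bar> \<le> \<epsilon> * (h (l p) M + h' (r p) M)"
      if p: "p \<in> Q" and \<epsilon>: "\<epsilon> \<in> T" for p \<epsilon>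
    proof -
      have "l p \<in> P" "r p \<in> P'" and sub: "p \<subseteq> l p" "p \<subseteq> r p"
        using lr[OF p] by auto
      from eventually_conj[OF h[rule_format, OF this(1) \<epsilon>] h'[rule_format, OF this(2) \<epsilon>]]
      show ?thesis
      proof (rule eventually_mono, intro allI impI)
        fix M bs
        assume A: "(\<forall>bs. (M, bs) \<in> l p \<longrightarrow> \<bar>c M bs - h (l p) M\<bar> \<le> \<epsilon> * h (l p) M) \<and>
          (\<forall>bs. (M, bs) \<in> r p \<longrightarrow> \<bar>c' M bs - h' (r p) M\<bar> \<le> \<epsilon> * h' (r p) M)"
          and "(M, bs) \<in> p"
        then have "\<bar>c M bs - h (l p) M\<bar> \<le> \<epsilon> * h (l p) M"
          "\<bar>c' M bs - h' (r p) M\<bar> \<le> \<epsilon> * h' (r p) M"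
          using sub by blast+
        then show "\<bar>c M bs + c' M bs - (h (l p) M + h' (r p) M)\<bar> \<le>
            \<epsilon> * (h (l p) M + h' (r p) M)"
          unfolding distrib_left by linarith
      qed
    qed
  qed
qed

text \<open>The start of the induction: the two classes are given by the formula and its negation, and
  an empty class must be discarded.\<close>

lemma measured_of_bool_sat:
  fixes R :: "(('f, 'r, 'a) struct \<Rightarrow> real) set"
  assumes "formula_in L \<phi> ys []" and "(\<lambda>M. 0) \<in> R" and "(\<lambda>M. 1) \<in> R"
    and "admissible_tolerances T"
  shows "measured T F L C R ys (\<lambda>M bs. of_bool (sat M (assignment ys bs) \<phi>))"
  unfolding measured_def
proof (intro exI conjI ballI)
  let ?S = "{(M, bs) \<in> pairs C ys. sat M (assignment ys bs) \<phi>}"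
  let ?N = "{(M, bs) \<in> pairs C ys. \<not> sat M (assignment ys bs) \<phi>}"
  let ?h = "\<lambda>\<pi> (M :: ('f, 'r, 'a) struct). if \<pi> = ?S then 1 else 0 :: real"
  show "definable_partition L C ys ({?S, ?N} - {{}})"
    using definable_partition_sat[OF assms(1)] .
  show "?h \<pi> \<in> R" for \<pi>
    using assms(2,3) by (cases "\<pi> = ?S") simp_all
  show "\<forall>\<^sub>F M in F. \<forall>bs. (M, bs) \<in> \<pi> \<longrightarrow>
      \<bar>of_bool (sat M (assignment ys bs) \<phi>) - ?h \<pi> M\<bar> \<le> \<epsilon> * ?h \<pi> M"
    if "\<pi> \<in> {?S, ?N} - {{}}" "\<epsilon> \<in> T" for \<pi> \<epsilon>
  proof -
    have "\<epsilon> \<ge> 0"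
      using assms(4) that(2) by (simp add: admissible_tolerances_def)
    moreover have "\<pi> = ?S \<or> \<pi> = ?N \<and> ?N \<noteq> ?S"
      using that(1) by blast
    ultimately show ?thesis
      by (intro always_eventually allI impI) auto
  qed
qed simp

text \<open>The measuring function \<open>0\<close> still comes with a definable partition, here the one given by an
  unsatisfiable sentence.\<close>

lemma measured_zero:
  assumes "distinct ys" and "(\<lambda>M. 0) \<in> R" and "(\<lambda>M. 1) \<in> R" and "admissible_tolerances T"
  shows "measured T F L C R ys (\<lambda>M bs. 0)"
proof -
  have "formula_in L (Exists 0 (Neg (Equal (Var 0) (Var 0)))) ys []"
    using assms(1) by (simp add: formula_in_def)
  from measured_of_bool_sat[OF this assms(2-4)] show ?thesis
    by simp
qed

lemma measured_sum:
  assumes "finite I" and "\<And>i. i \<in> I \<Longrightarrow> measured T F L C R ys (c i)"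
    and "measured T F L C R ys (\<lambda>M bs. 0)"
    and "\<And>f g. f \<in> R \<Longrightarrow> g \<in> R \<Longrightarrow> (\<lambda>M. f M + g M) \<in> R"
  shows "measured T F L C R ys (\<lambda>M bs. \<Sum>i\<in>I. c i M bs)"
  using assms(1,2)
proof (induction I rule: finite_induct)
  case empty
  then show ?case using assms(3) by simp
next
  case (insert i I)
  then have "measured T F L C R ys (\<lambda>M bs. c i M bs + (\<Sum>i\<in>I. c i M bs))"
    by (intro measured_add assms(4)) auto
  with insert.hyps show ?case by simp
qed

text \<open>If every fibre over \<open>S M bs\<close> has weight about \<open>h\<close> and \<open>S M bs\<close> has about \<open>g\<close> elements, then
  the total weight is about \<open>h * g\<close>. It is essential that the same \<open>h\<close> and the same exceptional
  structures serve all fibres, because the number of fibres is unbounded.\<close>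

lemma measured_fibre_sum:
  fixes S :: "('f, 'r, 'a) struct \<Rightarrow> 'a list \<Rightarrow> 'b set"
  assumes "admissible_tolerances T"
    and "measured T F L C R ys (\<lambda>M bs. real (card (S M bs)))"
    and "h \<in> R"
    and w: "\<And>\<epsilon>. \<epsilon> \<in> T \<Longrightarrow> \<forall>\<^sub>F M in F. \<forall>bs. (M, bs) \<in> pairs C ys \<longrightarrow>
          (\<forall>a\<in>S M bs. \<bar>w M bs a - h M\<bar> \<le> \<epsilon> * h M)"
    and mult: "\<And>f g. f \<in> R \<Longrightarrow> g \<in> R \<Longrightarrow> (\<lambda>M. f M * g M) \<in> R"
    and nonneg: "\<And>f M. f \<in> R \<Longrightarrow> M \<in> C \<Longrightarrow> f M \<ge> 0"
  shows "measured T F L C R ys (\<lambda>M bs. \<Sum>a\<in>S M bs. w M bs a)"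
proof -
  obtain P g where P: "finite P" "definable_partition L C ys P" "\<forall>\<pi>\<in>P. g \<pi> \<in> R"
    and g: "\<forall>\<pi>\<in>P. \<forall>\<epsilon>\<in>T.
      \<forall>\<^sub>F M in F. \<forall>bs. (M, bs) \<in> \<pi> \<longrightarrow> \<bar>real (card (S M bs)) - g \<pi> M\<bar> \<le> \<epsilon> * g \<pi> M"
    using assms(2) by (rule measuredE)
  show ?thesis
    unfolding measured_def
  proof (intro exI conjI ballI)
    show "finite P" "definable_partition L C ys P"
      by fact+
    show "(\<lambda>M. h M * g \<pi> M) \<in> R" if "\<pi> \<in> P" for \<pi>
      using that P(3) \<open>h \<in> R\<close> mult by blast
    fix \<pi> \<epsilon> assume \<pi>: "\<pi> \<in> P" and "\<epsilon> \<in> T"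
    then obtain \<delta> where \<delta>: "\<delta> \<in> T" "0 \<le> \<delta>" "\<delta> \<le> 1" "3 * \<delta> \<le> \<epsilon>"
      using assms(1) unfolding admissible_tolerances_def by meson
    have sub: "\<pi> \<subseteq> pairs C ys"
      using P(2) \<pi> partition_onD1 unfolding definable_partition_def by blast
    from eventually_conj[OF g[rule_format, OF \<pi> \<delta>(1)] w[OF \<delta>(1)]]
    show "\<forall>\<^sub>F M in F. \<forall>bs. (M, bs) \<in> \<pi> \<longrightarrow>
      \<bar>(\<Sum>a\<in>S M bs. w M bs a) - h M * g \<pi> M\<bar> \<le> \<epsilon> * (h M * g \<pi> M)"
    proof (rule eventually_mono, intro allI impI)
      fix M bs
      assume A: "(\<forall>bs. (M, bs) \<in> \<pi> \<longrightarrow> \<bar>real (card (S M bs)) - g \<pi> M\<bar> \<le> \<delta> * g \<pi> M) \<and>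
          (\<forall>bs. (M, bs) \<in> pairs C ys \<longrightarrow> (\<forall>a\<in>S M bs. \<bar>w M bs a - h M\<bar> \<le> \<delta> * h M))"
        and Mbs: "(M, bs) \<in> \<pi>"
      define N where "N = real (card (S M bs))"
      have "M \<in> C"
        using Mbs sub by (auto simp: pairs_def)
      then have h0: "h M \<ge> 0" and g0: "g \<pi> M \<ge> 0"
        using nonneg \<open>h \<in> R\<close> P(3) \<pi> by blast+
      have N: "\<bar>N - g \<pi> M\<bar> \<le> \<delta> * g \<pi> M"
        using A Mbs by (auto simp: N_def)
      have "\<delta> * g \<pi> M \<le> 1 * g \<pi> M"
        using \<delta>(3) g0 by (rule mult_right_mono)
      with N have N2: "N \<le> 2 * g \<pi> M"
        by linarith
      \<comment> \<open>Compare with \<open>N * h\<close> first: the fibres cost \<open>N \<le> 2 g\<close> times \<open>\<delta> h\<close>, and replacing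
        \<open>N\<close> by \<open>g\<close> costs another \<open>\<delta> h g\<close>.\<close>
      have "\<bar>(\<Sum>a\<in>S M bs. w M bs a) - N * h M\<bar> = \<bar>\<Sum>a\<in>S M bs. w M bs a - h M\<bar>"
        by (simp add: sum_subtractf N_def)
      also have "\<dots> \<le> (\<Sum>a\<in>S M bs. \<delta> * h M)"
        using A Mbs sub by (intro order.trans[OF sum_abs] sum_mono) blast
      also have "\<dots> = N * (\<delta> * h M)"
        by (simp add: N_def)
      also have "\<dots> \<le> 2 * g \<pi> M * (\<delta> * h M)"
        using N2 \<delta>(2) h0 by (intro mult_right_mono) auto
      finally have "\<bar>(\<Sum>a\<in>S M bs. w M bs a) - N * h M\<bar> \<le> 2 * \<delta> * (h M * g \<pi> M)"
        by (simp add: mult_ac)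
      moreover have "\<bar>N * h M - h M * g \<pi> M\<bar> \<le> \<delta> * (h M * g \<pi> M)"
      proof -
        have "\<bar>N * h M - h M * g \<pi> M\<bar> = h M * \<bar>N - g \<pi> M\<bar>"
          using h0 by (metis abs_mult abs_of_nonneg mult.commute right_diff_distrib)
        also have "\<dots> \<le> h M * (\<delta> * g \<pi> M)"
          using N h0 by (rule mult_left_mono)
        finally show ?thesis by (simp add: mult_ac)
      qed
      ultimately have "\<bar>(\<Sum>a\<in>S M bs. w M bs a) - h M * g \<pi> M\<bar> \<le> 3 * \<delta> * (h M * g \<pi> M)"
        by linarith
      also have "\<dots> \<le> \<epsilon> * (h M * g \<pi> M)"
        using \<delta>(4) h0 g0 by (intro mult_right_mono) auto
      finally show "\<bar>(\<Sum>a\<in>S M bs. w M bs a) - h M * g \<pi> M\<bar> \<le> \<epsilon> * (h M * g \<pi> M)" .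
    qed
  qed
qed

section \<open>Non-negative elements of the generated ring\<close>

lemma generated_nonneg_incl:
  assumes "R \<subseteq> C \<rightarrow> {0..}" and "h \<in> R"
  shows "h \<in> generated_nonneg C R"
  using assms generate_ring.incl[of h R real_fun_ring]
  by (auto simp: generated_nonneg_def generated_ring_def)

lemma generated_nonneg_one: "(\<lambda>M. 1) \<in> generated_nonneg C R"
  using generate_ring.one[of real_fun_ring R]
  by (auto simp: generated_nonneg_def generated_ring_def real_fun_ring_def)

lemma generated_nonneg_zero: "(\<lambda>M. 0) \<in> generated_nonneg C R"
proof -
  interpret cring "real_fun_ring :: ('a \<Rightarrow> real) ring"
    by (rule cring_real_fun_ring)
  have "R \<subseteq> carrier real_fun_ring"
    by (simp add: real_fun_ring_def)
  then have "subring (generate_ring real_fun_ring R) real_fun_ring"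
    by (rule generate_ring_is_subring)
  then have "\<zero>\<^bsub>real_fun_ring\<^esub> \<in> generate_ring real_fun_ring R"
    by (rule subringE(2))
  then show ?thesis
    by (simp add: generated_nonneg_def generated_ring_def real_fun_ring_def)
qed

lemma generated_nonneg_add:
  assumes "f \<in> generated_nonneg C R" and "g \<in> generated_nonneg C R"
  shows "(\<lambda>M. f M + g M) \<in> generated_nonneg C R"
  using assms generate_ring.eng_add[of f real_fun_ring R g]
  by (auto simp: generated_nonneg_def generated_ring_def real_fun_ring_def)

lemma generated_nonneg_mult:
  assumes "f \<in> generated_nonneg C R" and "g \<in> generated_nonneg C R"
  shows "(\<lambda>M. f M * g M) \<in> generated_nonneg C R"
  using assms generate_ring.eng_mult[of f real_fun_ring R g]
  by (auto simp: generated_nonneg_def generated_ring_def real_fun_ring_def)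

section \<open>Induction on the number of object variables\<close>

lemma card_solutions_Nil:
  "card (solutions M \<phi> [] ys bs) = of_bool (sat M (assignment ys bs) \<phi>)"
proof -
  have "solutions M \<phi> [] ys bs = (if sat M (assignment ys bs) \<phi> then {[]} else {})"
    by (auto simp: solutions_def tuples_def)
  then show ?thesis by simp
qed

text \<open>Splitting off the first variable and sorting the remaining tuples by the class
  of \<open>(M, as @ bs)\<close>. Inside the class \<open>\<pi>\<close> the inner cardinalities are all measured by one
  function.\<close>

lemma card_solutions_Cons:
  assumes "partition_on (pairs C (xs @ ys)) P" and "finite P"
    and \<psi>: "\<And>\<pi> cs. \<pi> \<in> P \<Longrightarrow> cs \<in> tuples M (length (xs @ ys)) \<Longrightarrow>
          sat M (assignment (xs @ ys) cs) (\<psi> \<pi>) \<longleftrightarrow> (M, cs) \<in> \<pi>"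
    and "M \<in> C" and "finite (univ M)" and "bs \<in> tuples M (length ys)"
  shows "card (solutions M \<phi> (x # xs) ys bs) =
    (\<Sum>\<pi>\<in>P. \<Sum>as\<in>solutions M (\<psi> \<pi>) xs ys bs. card (solutions M \<phi> [x] (xs @ ys) (as @ bs)))"
proof -
  have fin: "finite (tuples M n)" for n
    using assms(5) finite_lists_length_eq[of "univ M" n] by (simp add: tuples_def)
  have app: "as @ bs \<in> tuples M (length (xs @ ys))" if "as \<in> tuples M (length xs)" for as
    using that assms(6) by (auto simp: tuples_def)
  have fins: "finite (solutions M \<chi> zs vs cs)" for \<chi> zs vs cs
    using fin by (simp add: solutions_def)
  have sol: "solutions M (\<psi> \<pi>) xs ys bs = {as \<in> tuples M (length xs). (M, as @ bs) \<in> \<pi>}"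
    if "\<pi> \<in> P" for \<pi>
    using \<psi>[OF that] app by (auto simp: solutions_def)
  have tup: "tuples M (length xs) = (\<Union>\<pi>\<in>P. solutions M (\<psi> \<pi>) xs ys bs)"
  proof -
    have "\<exists>\<pi>\<in>P. (M, as @ bs) \<in> \<pi>" if "as \<in> tuples M (length xs)" for as
    proof -
      have "(M, as @ bs) \<in> pairs C (xs @ ys)"
        using app[OF that] \<open>M \<in> C\<close> by (simp add: pairs_def)
      then show ?thesis
        using partition_onD1[OF assms(1)] by blast
    qed
    then show ?thesis by (auto simp: sol)
  qed
  have "solutions M \<phi> (x # xs) ys bs = (\<lambda>(as, as'). as' @ as) `
      (SIGMA as:tuples M (length xs). solutions M \<phi> [x] (xs @ ys) (as @ bs))"
    (is "?A = ?f ` ?B")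
  proof (intro equalityI subsetI)
    fix zs assume "zs \<in> ?A"
    then obtain a as where "zs = a # as" "a \<in> univ M" "as \<in> tuples M (length xs)"
      "sat M (assignment (x # xs @ ys) (a # as @ bs)) \<phi>"
      by (cases zs) (auto simp: solutions_def tuples_def)
    then show "zs \<in> ?f ` ?B"
      by (intro image_eqI[of _ _ "(as, [a])"]) (auto simp: solutions_def tuples_def)
  next
    fix zs assume "zs \<in> ?f ` ?B"
    then show "zs \<in> ?A"
      by (auto simp: solutions_def tuples_def length_Suc_conv)
  qed
  moreover have "inj_on ?f ?B"
    by (rule inj_onI) (auto simp: solutions_def tuples_def)
  ultimately have "card (solutions M \<phi> (x # xs) ys bs) = card ?B"
    by (simp add: card_image)
  also have "\<dots> = (\<Sum>as\<in>tuples M (length xs). card (solutions M \<phi> [x] (xs @ ys) (as @ bs)))"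
    using fin fins by (intro card_SigmaI) auto
  also have "\<dots> = (\<Sum>\<pi>\<in>P. \<Sum>as\<in>solutions M (\<psi> \<pi>) xs ys bs.
      card (solutions M \<phi> [x] (xs @ ys) (as @ bs)))"
    unfolding tup
  proof (rule sum.UNION_disjoint)
    show "\<forall>\<pi>\<in>P. \<forall>\<pi>'\<in>P. \<pi> \<noteq> \<pi>' \<longrightarrow>
        solutions M (\<psi> \<pi>) xs ys bs \<inter> solutions M (\<psi> \<pi>') xs ys bs = {}"
      using partition_onD2[OF assms(1)] by (auto simp: sol disjoint_def)
  qed (use assms(2) fins in auto)
  finally show ?thesis .
qed

text \<open>The induction must be for all formulas simultaneously: the induction hypothesis is applied to
  the formulas \<open>\<psi>\<^sub>\<pi>\<close> defining the classes for \<open>\<phi>(x; xs, ys)\<close>, not to a formula derived from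
  \<open>\<phi>\<close> itself.\<close>

lemma measured_card_solutions:
  fixes C :: "('f, 'r, 'a) struct set"
  assumes fin: "\<And>M. M \<in> C \<Longrightarrow> finite (univ M)"
    and R: "R \<subseteq> C \<rightarrow> {0..}"
    and T: "admissible_tolerances T"
    and single: "\<And>\<phi> x ys. formula_in L \<phi> [x] ys \<Longrightarrow>
      measured T F L C R ys (\<lambda>M bs. real (card (solutions M \<phi> [x] ys bs)))"
    and "formula_in L \<phi> xs ys"
  shows "measured T F L C (generated_nonneg C R) ys
    (\<lambda>M bs. real (card (solutions M \<phi> xs ys bs)))"
  using assms(5)
proof (induction xs arbitrary: \<phi>)
  case Nil
  then have "formula_in L \<phi> ys []"
    by (simp add: formula_in_def)
  from measured_of_bool_sat[OF this generated_nonneg_zero generated_nonneg_one T]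
  show ?case by (simp add: card_solutions_Nil)
next
  case (Cons x xs)
  then have "formula_in L \<phi> [x] (xs @ ys)"
    by (simp add: formula_in_def)
  from single[OF this] obtain P h where P: "finite P" "definable_partition L C (xs @ ys) P"
      "\<forall>\<pi>\<in>P. h \<pi> \<in> R"
    and h: "\<forall>\<pi>\<in>P. \<forall>\<epsilon>\<in>T.
      \<forall>\<^sub>F M in F. \<forall>cs. (M, cs) \<in> \<pi> \<longrightarrow>
      \<bar>real (card (solutions M \<phi> [x] (xs @ ys) cs)) - h \<pi> M\<bar> \<le> \<epsilon> * h \<pi> M"
    by (rule measuredE)
  have "\<forall>\<pi>\<in>P. \<exists>\<psi>. formula_in L \<psi> (xs @ ys) [] \<and>
      (\<forall>(M, cs)\<in>pairs C (xs @ ys). sat M (assignment (xs @ ys) cs) \<psi> \<longleftrightarrow> (M, cs) \<in> \<pi>)"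
    using P(2) by (simp add: definable_partition_iff)
  from bchoice[OF this] obtain \<psi> where \<psi>: "\<forall>\<pi>\<in>P. formula_in L (\<psi> \<pi>) (xs @ ys) [] \<and>
      (\<forall>(M, cs)\<in>pairs C (xs @ ys). sat M (assignment (xs @ ys) cs) (\<psi> \<pi>) \<longleftrightarrow> (M, cs) \<in> \<pi>)"
    ..
  have "measured T F L C (generated_nonneg C R) ys (\<lambda>M bs. \<Sum>as\<in>solutions M (\<psi> \<pi>) xs ys bs.
      real (card (solutions M \<phi> [x] (xs @ ys) (as @ bs))))" if \<pi>: "\<pi> \<in> P" for \<pi>
  proof (rule measured_fibre_sum[OF T])
    show "measured T F L C (generated_nonneg C R) ys
        (\<lambda>M bs. real (card (solutions M (\<psi> \<pi>) xs ys bs)))"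
      using \<psi>[THEN bspec, OF \<pi>] by (intro Cons.IH) (simp add: formula_in_def)
    show "h \<pi> \<in> generated_nonneg C R"
      using P(3) \<pi> R generated_nonneg_incl by blast
    show "\<forall>\<^sub>F M in F. \<forall>bs. (M, bs) \<in> pairs C ys \<longrightarrow> (\<forall>as\<in>solutions M (\<psi> \<pi>) xs ys bs.
        \<bar>real (card (solutions M \<phi> [x] (xs @ ys) (as @ bs))) - h \<pi> M\<bar> \<le> \<epsilon> * h \<pi> M)"
      if "\<epsilon> \<in> T" for \<epsilon>
      using h[rule_format, OF \<pi> that]
    proof (rule eventually_mono, intro allI impI ballI)
      fix M bs as
      assume A: "\<forall>cs. (M, cs) \<in> \<pi> \<longrightarrow>
          \<bar>real (card (solutions M \<phi> [x] (xs @ ys) cs)) - h \<pi> M\<bar> \<le> \<epsilon> * h \<pi> M"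
        and "(M, bs) \<in> pairs C ys" and as: "as \<in> solutions M (\<psi> \<pi>) xs ys bs"
      then have "(M, as @ bs) \<in> pairs C (xs @ ys)"
        by (auto simp: pairs_def solutions_def tuples_def)
      then have "(M, as @ bs) \<in> \<pi>"
        using \<psi>[THEN bspec, OF \<pi>] as by (auto simp: solutions_def)
      then show "\<bar>real (card (solutions M \<phi> [x] (xs @ ys) (as @ bs))) - h \<pi> M\<bar> \<le> \<epsilon> * h \<pi> M"
        using A by blast
    qed
    show "f M \<ge> 0" if "f \<in> generated_nonneg C R" "M \<in> C" for f M
      using that by (simp add: generated_nonneg_def)
  qed (rule generated_nonneg_mult)
  then have "measured T F L C (generated_nonneg C R) ys (\<lambda>M bs. \<Sum>\<pi>\<in>P.
      \<Sum>as\<in>solutions M (\<psi> \<pi>) xs ys bs. real (card (solutions M \<phi> [x] (xs @ ys) (as @ bs))))"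
  proof (rule measured_sum[OF P(1)])
    show "measured T F L C (generated_nonneg C R) ys (\<lambda>M bs. 0)"
      using Cons.prems by (intro measured_zero generated_nonneg_zero generated_nonneg_one T)
        (simp add: formula_in_def)
  qed (assumption, rule generated_nonneg_add)
  then show ?case
  proof (rule measured_cong)
    fix M :: "('f, 'r, 'a) struct" and bs assume "(M, bs) \<in> pairs C ys"
    then have "M \<in> C" "bs \<in> tuples M (length ys)"
      by (simp_all add: pairs_def)
    have "card (solutions M \<phi> (x # xs) ys bs) = (\<Sum>\<pi>\<in>P. \<Sum>as\<in>solutions M (\<psi> \<pi>) xs ys bs.
        card (solutions M \<phi> [x] (xs @ ys) (as @ bs)))"
    proof (rule card_solutions_Cons)
      show "partition_on (pairs C (xs @ ys)) P"
        using P(2) by (simp add: definable_partition_def)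
      show "sat M (assignment (xs @ ys) cs) (\<psi> \<pi>) \<longleftrightarrow> (M, cs) \<in> \<pi>"
        if "\<pi> \<in> P" "cs \<in> tuples M (length (xs @ ys))" for \<pi> cs
        using \<psi>[THEN bspec, OF that(1)] that(2) \<open>M \<in> C\<close> by (auto simp: pairs_def)
    qed (use P(1) fin \<open>M \<in> C\<close> \<open>bs \<in> tuples M (length ys)\<close> in auto)
    then show "(\<Sum>\<pi>\<in>P. \<Sum>as\<in>solutions M (\<psi> \<pi>) xs ys bs.
        real (card (solutions M \<phi> [x] (xs @ ys) (as @ bs)))) =
      real (card (solutions M \<phi> (x # xs) ys bs))"
      by simp
  qed
qed

theorem theorem2p4p1:
  fixes L :: "('f, 'r) language"
    and C :: "('f, 'r, 'a) struct set"
    and R :: "(('f, 'r, 'a) struct \<Rightarrow> real) set"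
  assumes "\<And>M. M \<in> C \<Longrightarrow> is_structure L M \<and> finite (univ M)"
    and "R \<subseteq> C \<rightarrow> {0..}"
  shows "((\<forall>\<phi> x ys. formula_in L \<phi> [x] ys \<longrightarrow> mac_formula L C R \<phi> [x] ys) \<longrightarrow>
            is_mac L C (generated_nonneg C R)) \<and>
         ((\<forall>\<phi> x ys. formula_in L \<phi> [x] ys \<longrightarrow> mec_formula L C R \<phi> [x] ys) \<longrightarrow>
            is_mec L C (generated_nonneg C R))"
proof (intro conjI impI)
  have "\<exists>\<delta>>0. \<delta> \<le> 1 \<and> 3 * \<delta> \<le> \<epsilon>" if "\<epsilon> > 0" for \<epsilon> :: real
    using that by (intro exI[of _ "min 1 (\<epsilon> / 3)"]) auto
  then have T: "admissible_tolerances {0<..}" "admissible_tolerances {0}"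
    by (auto simp: admissible_tolerances_def Bex_def)
  have fin: "finite (univ M)" if "M \<in> C" for M
    using assms(1) that by blast
  note transfer = measured_card_solutions[OF fin assms(2)]
  show "is_mac L C (generated_nonneg C R)"
    if "\<forall>\<phi> x ys. formula_in L \<phi> [x] ys \<longrightarrow> mac_formula L C R \<phi> [x] ys"
    using that transfer[OF _ T(1)] unfolding is_mac_def mac_formula_iff_measured by blast
  show "is_mec L C (generated_nonneg C R)"
    if "\<forall>\<phi> x ys. formula_in L \<phi> [x] ys \<longrightarrow> mec_formula L C R \<phi> [x] ys"
    using that transfer[OF _ T(2)] unfolding is_mec_def mec_formula_iff_measured by blast
qed

end
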